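(* Let $n\ge k>a\ge 0$ be integers. If $n\ge \left(a+\frac52\right)(k-a+2)-6$ and $k-2\ge a\ge k/2$, then $B(J(n,k,a))= a+2$.
   Context: All graphs are finite, undirected, without loops or multiple edges. In a zero forcing process, the vertices of a graph are initially colored black or white; whenever there is a black vertex adjacent to exactly one white vertex, that white vertex is forced to become black, and this is repeated as long as possible. An initial set of black vertices is a zero forcing set if eventually all vertices of the graph become black; otherwise it is a failed zero forcing set, and its complement (the initial set of white vertices) is called a zero blocking set. The zero blocking number $B(G)$ of $G$ is the minimum size of a zero blocking set of $G$. Let $[n]=\{1,2,\ldots,n\}$. For integers $n\ge k>a\ge 0$, the generalized Johnson graph $J(n,k,a)$ is the graph whose vertices are the $k$-subsets of $[n]$, where two vertices $A$ and $B$ are adjacent if and only if $|A\cap B|=a$. *)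

theory Defs
  imports "Graph_Theory.Pair_Digraph" Complex_Main
begin

(* A finite simple graph is a pair_graph: a finite loopless digraph without parallel arcs whose
   arc set is symmetric, an undirected edge uv being the two arcs (u,v) and (v,u). *)

definition force_step :: "'a pair_pre_digraph \<Rightarrow> 'a set \<Rightarrow> 'a set \<Rightarrow> bool" where
  "force_step G S T \<longleftrightarrow>
     (\<exists>u\<in>S. \<exists>v. {w. (u, w) \<in> parcs G \<and> w \<notin> S} = {v} \<and> T = insert v S)"

(* The order of the forces is irrelevant: by final_colouring_unique below, a process that has
   stopped has reached the largest black set reachable from its initial one. *)
definition zero_forcing_set :: "'a pair_pre_digraph \<Rightarrow> 'a set \<Rightarrow> bool" where
  "zero_forcing_set G S \<longleftrightarrow> S \<subseteq> pverts G \<and> (force_step G)\<^sup>*\<^sup>* S (pverts G)"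

definition failed_zero_forcing_set :: "'a pair_pre_digraph \<Rightarrow> 'a set \<Rightarrow> bool" where
  "failed_zero_forcing_set G S \<longleftrightarrow> S \<subseteq> pverts G \<and> \<not> zero_forcing_set G S"

definition zero_blocking_set :: "'a pair_pre_digraph \<Rightarrow> 'a set \<Rightarrow> bool" where
  "zero_blocking_set G W \<longleftrightarrow> W \<subseteq> pverts G \<and> failed_zero_forcing_set G (pverts G - W)"

(* The minimum is attained as soon as G has a vertex, see zero_blocking_set_pverts. *)
definition zero_blocking_number :: "'a pair_pre_digraph \<Rightarrow> nat" where
  "zero_blocking_number G = (LEAST m. \<exists>W. zero_blocking_set G W \<and> card W = m)"

definition gen_johnson :: "nat \<Rightarrow> nat \<Rightarrow> nat \<Rightarrow> nat set pair_pre_digraph" where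
  "gen_johnson n k a =
     \<lparr> pverts = {A. A \<subseteq> {1..n} \<and> card A = k},
       parcs = {(A, B). A \<subseteq> {1..n} \<and> card A = k \<and> B \<subseteq> {1..n} \<and> card B = k \<and> card (A \<inter> B) = a} \<rparr>"

lemma final_colouring_unique:
  assumes final: "(force_step G)\<^sup>*\<^sup>* S T" "\<nexists>U. force_step G T U"
    and reach: "(force_step G)\<^sup>*\<^sup>* S T'"
  shows "T' \<subseteq> T"
  using reach
proof (induction rule: rtranclp_induct)
  case base
  show ?case
    using final(1) by (induction rule: rtranclp_induct) (auto simp: force_step_def)
next
  case (step U U')
  then obtain u v where u: "u \<in> U" "{w. (u, w) \<in> parcs G \<and> w \<notin> U} = {v}" "U' = insert v U"
    by (auto simp: force_step_def)
  have "v \<in> T"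
  proof (rule ccontr)
    assume "v \<notin> T"
    then have "{w. (u, w) \<in> parcs G \<and> w \<notin> T} = {v}" using u(2) step.IH by blast
    then have "force_step G T (insert v T)" using u(1) step.IH by (auto simp: force_step_def)
    then show False using final(2) by blast
  qed
  then show ?case using u(3) step.IH by simp
qed

lemma zero_blocking_set_pverts:
  assumes "pverts G \<noteq> {}"
  shows "zero_blocking_set G (pverts G)"
proof -
  have "T = {}" if "(force_step G)\<^sup>*\<^sup>* {} T" for T
    using that by (induction rule: rtranclp_induct) (auto simp: force_step_def)
  then show ?thesis
    using assms by (auto simp: zero_blocking_set_def failed_zero_forcing_set_def zero_forcing_set_def)
qed

lemma pair_graph_gen_johnson:
  assumes "a < k"
  shows "pair_graph (gen_johnson n k a)"
proof -
  let ?V = "{A. A \<subseteq> {1..n} \<and> card A = k}"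
  have fin: "finite ?V" by simp
  have "parcs (gen_johnson n k a) \<subseteq> ?V \<times> ?V" by (auto simp: gen_johnson_def)
  then have fin_arcs: "finite (parcs (gen_johnson n k a))"
    by (rule finite_subset) (intro finite_cartesian_product fin)
  have sym: "symmetric (with_proj (gen_johnson n k a))"
    unfolding symmetric_def with_proj_simps by (rule symI) (simp add: gen_johnson_def Int_commute)
  have irrefl: "fst e \<noteq> snd e" if "e \<in> parcs (gen_johnson n k a)" for e
    using that assms by (cases e) (simp add: gen_johnson_def, metis Int_absorb less_irrefl)
  show ?thesis
    using fin fin_arcs sym irrefl by unfold_locales (simp_all add: gen_johnson_def split_beta)
qed

end

theory Submission
  imports Defs
begin

text \<open>
  Upper bound: the \<open>a + 2\<close> sets \<open>X - {y}\<close>, where \<open>card X = k + 1\<close> and \<open>y\<close> ranges over a subset of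
  \<open>X\<close> of size \<open>a + 2\<close>, form a white set from which no vertex at all can force.

  Lower bound: let \<open>W\<close> be a nonempty white set with at most \<open>a + 1\<close> elements and let
  \<open>B0 \<in> W\<close>. Picking an element of \<open>B0 - B\<close> for each of the at most \<open>a\<close> other \<open>B \<in> W\<close> gives an
  \<open>a\<close>-subset \<open>A0\<close> of \<open>B0\<close> contained in no other \<open>B\<close>. Enlarge \<open>A0\<close> greedily by \<open>d = k - a\<close> elements
  \<open>Z\<close> outside \<open>B0\<close>, keeping \<open>card (Z \<inter> B) < card (A0 - B)\<close>; then \<open>A0 \<union> Z\<close> meets \<open>B0\<close> in \<open>a\<close>
  elements and every other \<open>B\<close> in fewer, so it forces \<open>B0\<close>. A new element is excluded only by those
  \<open>B\<close> for which the inequality is tight, and such a \<open>B\<close> excludes at most \<open>d + 1\<close> new elements.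
  Hence \<open>n \<ge> a * (d + 2) + 2 * d\<close> suffices.
\<close>

lemma exists_subset_not_included:
  assumes "finite B0" "finite F" "card F \<le> a" "a \<le> card B0" "\<And>B. B \<in> F \<Longrightarrow> \<not> B0 \<subseteq> B"
  obtains A0 where "A0 \<subseteq> B0" "card A0 = a" "\<And>B. B \<in> F \<Longrightarrow> \<not> A0 \<subseteq> B"
proof -
  have "\<forall>B\<in>F. \<exists>x. x \<in> B0 - B" using assms(5) by blast
  then obtain x where x: "\<And>B. B \<in> F \<Longrightarrow> x B \<in> B0 - B" by metis
  have "card (x ` F) \<le> a" using card_image_le[OF assms(2), of x] assms(3) by linarith
  moreover have "x ` F \<subseteq> B0" using x by blast
  ultimately obtain A0 where A0: "x ` F \<subseteq> A0" "A0 \<subseteq> B0" "card A0 = a"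
    using exists_subset_between[of "x ` F" a B0] assms(1,4) by metis
  show thesis
  proof (rule that[OF A0(2,3)])
    show "\<not> A0 \<subseteq> B" if "B \<in> F" for B using x[OF that] A0(1) that by blast
  qed
qed

text \<open>The size \<open>j\<close> is kept apart from \<open>d\<close> so that induction can add
  one point at a time; only \<open>j = d\<close> is used later. The induction starts from
  \<open>\<not> A0 \<subseteq> B\<close>, and \<open>room\<close> leaves a free point at each
  step.\<close>

lemma exists_greedy_extension:
  assumes "finite V" "A0 \<subseteq> B0" "B0 \<subseteq> V" "finite F"
    and F: "\<And>B. B \<in> F \<Longrightarrow> B \<subseteq> V \<and> card B = card B0 \<and> \<not> A0 \<subseteq> B"
    and d: "card B0 = card A0 + d"
    and room: "card F * (d + 1) + d \<le> card (V - B0)"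
    and "j \<le> d"
  shows "\<exists>Z \<subseteq> V - B0. card Z = j \<and> (\<forall>B\<in>F. card (Z \<inter> B) < card (A0 - B))"
  using \<open>j \<le> d\<close>
proof (induction j)
  case 0
  have "card (A0 - B) > 0" if "B \<in> F" for B
    using F[OF that] assms(1-3) by (subst card_gt_0_iff) (meson Diff_eq_empty_iff finite_Diff finite_subset)
  then show ?case by (intro exI[of _ "{}"]) simp
next
  case (Suc j)
  then obtain Z where Z: "Z \<subseteq> V - B0" "card Z = j"
      and less: "\<And>B. B \<in> F \<Longrightarrow> card (Z \<inter> B) < card (A0 - B)"
    by auto
  have fB0: "finite B0" and fA0: "finite A0" and fZ: "finite Z"
    using assms(1-3) Z(1) by (meson finite_Diff finite_subset)+
  \<comment> \<open>A new point raises \<open>card (Z \<inter> B)\<close> by at most one, so only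
    these tight \<open>B\<close> can break the strict inequality.\<close>
  let ?T = "{B \<in> F. card (A0 - B) = Suc (card (Z \<inter> B))}"
  \<comment> \<open>As \<open>B\<close> and \<open>B0\<close> have equal size, \<open>card (B - B0)
    = card (B0 - B) \<le> card (A0 - B) + d = card (Z \<inter> B) + 1 + d\<close>. The points of
    \<open>Z \<inter> B\<close> are already chosen, which leaves at most
    \<open>d + 1\<close>.\<close>
  have excluded: "card (B - B0 - Z) \<le> d + 1" if "B \<in> ?T" for B
  proof -
    have B: "B \<subseteq> V" "card B = card B0" and tight: "card (A0 - B) = Suc (card (Z \<inter> B))"
      using that F by auto
    have fB: "finite B" using B(1) assms(1) by (rule finite_subset)
    have "card (B - B0) = card (B0 - B)"
      using B(2) card_Diff_subset_Int[of B B0] card_Diff_subset_Int[of B0 B] fB fB0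
      by (simp add: Int_commute)
    also have "\<dots> \<le> card (A0 - B) + card (B0 - A0)"
    proof -
      have "card (B0 - B) \<le> card ((A0 - B) \<union> (B0 - A0))"
        using fA0 fB0 by (intro card_mono) auto
      then show ?thesis using card_Un_le[of "A0 - B" "B0 - A0"] by linarith
    qed
    also have "card (B0 - A0) = d"
      using d card_Diff_subset[OF fA0 assms(2)] by simp
    finally have "card (B - B0) \<le> card (Z \<inter> B) + 1 + d" using tight by simp
    moreover have "card (B - B0) = card (B - B0 - Z) + card (Z \<inter> B)"
    proof -
      have "(B - B0 - Z) \<union> (Z \<inter> B) = B - B0" using Z(1) by blast
      moreover have "(B - B0 - Z) \<inter> (Z \<inter> B) = {}" by blast
      ultimately show ?thesis
        using card_Un_disjoint[of "B - B0 - Z" "Z \<inter> B"] fB fZ by simp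
    qed
    ultimately show ?thesis by linarith
  qed
  let ?U = "\<Union>B\<in>?T. B - B0 - Z"
  have "card ?U \<le> (\<Sum>B\<in>?T. card (B - B0 - Z))"
    using assms(4) by (intro card_UN_le) simp
  also have "\<dots> \<le> card ?T * (d + 1)"
    using sum_bounded_above[of ?T "\<lambda>B. card (B - B0 - Z)" "d + 1"] excluded by simp
  also have "\<dots> \<le> card F * (d + 1)"
    using assms(4) by (intro mult_right_mono card_mono) auto
  \<comment> \<open>Strict because \<open>card Z = j < d\<close>, the summand reserved for
    \<open>Z\<close> in \<open>room\<close>.\<close>
  finally have "card (Z \<union> ?U) < card (V - B0)"
    using room Z(2) Suc.prems card_Un_le[of Z ?U] by linarith
  moreover have "finite (Z \<union> ?U)" using fZ F assms(1,4) by (auto intro: finite_subset)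
  ultimately obtain v where v: "v \<in> V - B0" "v \<notin> Z \<union> ?U"
    by (meson card_mono not_le subsetI)
  have "card (insert v Z \<inter> B) < card (A0 - B)" if "B \<in> F" for B
  proof (cases "v \<in> B")
    case True
    then have "card (A0 - B) \<noteq> Suc (card (Z \<inter> B))" using v that by auto
    then show ?thesis using less[OF that] True v(2) fZ by (simp add: Int_insert_left)
  qed (use less[OF that] in simp)
  then show ?case using Z v fZ by (intro exI[of _ "insert v Z"]) auto
qed

text \<open>This supplies one force: \<open>A\<close> is black because \<open>A \<notin> W\<close>,
  and \<open>B0\<close> is its only white neighbour.\<close>

lemma exists_unique_neighbour:
  assumes W: "finite W" "W \<noteq> {}" "card W \<le> a + 1"
      "\<And>B. B \<in> W \<Longrightarrow> B \<subseteq> V \<and> card B = a + d"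
    and "finite V" "a * (d + 2) + 2 * d \<le> card V" "d > 0"
  shows "\<exists>A. A \<subseteq> V \<and> card A = a + d \<and> A \<notin> W \<and> (\<exists>B0. {B \<in> W. card (A \<inter> B) = a} = {B0})"
proof -
  obtain B0 where B0: "B0 \<in> W" using W(2) by blast
  let ?F = "W - {B0}"
  have B0V: "B0 \<subseteq> V" "card B0 = a + d" using W(4)[OF B0] by auto
  have fB0: "finite B0" using B0V(1) assms(5) by (rule finite_subset)
  have cardF: "card ?F \<le> a" using W(1,3) B0 by simp
  have "\<not> B0 \<subseteq> B" if "B \<in> ?F" for B
    using that W(4)[of B] B0V assms(5) card_subset_eq[of B B0] by (auto dest: finite_subset)
  then obtain A0 where A0: "A0 \<subseteq> B0" "card A0 = a" "\<And>B. B \<in> ?F \<Longrightarrow> \<not> A0 \<subseteq> B"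
    using exists_subset_not_included[of B0 ?F a] fB0 W(1) cardF B0V(2) by auto
  have "card ?F * (d + 1) \<le> a * (d + 1)" using cardF by (rule mult_right_mono) simp
  \<comment> \<open>Removing the \<open>a + d\<close> points of \<open>B0\<close> from at least
    \<open>a * (d + 2) + 2 * d\<close> points leaves at least
    \<open>a * (d + 1) + d\<close>.\<close>
  then have "card ?F * (d + 1) + d \<le> card (V - B0)"
    using assms(6) B0V fB0 by (simp add: card_Diff_subset algebra_simps)
  then have "\<exists>Z \<subseteq> V - B0. card Z = d \<and> (\<forall>B\<in>?F. card (Z \<inter> B) < card (A0 - B))"
    using A0 B0V W(1,4) assms(5)
    by (intro exists_greedy_extension[where d = d]) auto
  then obtain Z where Z: "Z \<subseteq> V - B0" "card Z = d"
      and less: "\<And>B. B \<in> ?F \<Longrightarrow> card (Z \<inter> B) < card (A0 - B)"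
    by blast
  have fA0: "finite A0" using A0(1) fB0 by (rule finite_subset)
  have fZ: "finite Z" using Z(2) \<open>d > 0\<close> by (simp add: card_ge_0_finite)
  have disj: "A0 \<inter> Z = {}" using Z(1) A0(1) by blast
  have cardA: "card (A0 \<union> Z) = a + d"
    using card_Un_disjoint[OF fA0 fZ disj] A0(2) Z(2) by simp
  have "(A0 \<union> Z) \<inter> B0 = A0" using Z(1) A0(1) by blast
  then have meets_B0: "card ((A0 \<union> Z) \<inter> B0) = a" using A0(2) by simp
  have meets: "card ((A0 \<union> Z) \<inter> B) < a" if "B \<in> ?F" for B
  proof -
    have "card ((A0 \<union> Z) \<inter> B) \<le> card (A0 \<inter> B) + card (Z \<inter> B)"
      by (metis Int_Un_distrib2 card_Un_le)
    also have "\<dots> < card (A0 \<inter> B) + card (A0 - B)" using less[OF that] by simp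
    also have "\<dots> = a" using card_Int_Diff[OF fA0, of B] A0(2) by simp
    finally show ?thesis .
  qed
  \<comment> \<open>The set meets itself in \<open>a + d > a\<close> points, but each member of
    \<open>W\<close> in at most \<open>a\<close>.\<close>
  have "A0 \<union> Z \<notin> W"
  proof
    assume "A0 \<union> Z \<in> W"
    then show False
      using meets[of "A0 \<union> Z"] meets_B0 cardA \<open>d > 0\<close> by (cases "A0 \<union> Z = B0") auto
  qed
  moreover have "{B \<in> W. card ((A0 \<union> Z) \<inter> B) = a} = {B0}"
    using B0 meets_B0 meets by (auto dest: less_imp_neq)
  moreover have "A0 \<union> Z \<subseteq> V" using A0(1) B0V(1) Z(1) by blast
  ultimately show ?thesis using cardA by blast
qed

lemma zero_forcing_set_gen_johnson:
  assumes "W \<subseteq> pverts (gen_johnson n (a + d) a)" "card W \<le> a + 1"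
    and n: "a * (d + 2) + 2 * d \<le> n" and "d > 0"
  shows "zero_forcing_set (gen_johnson n (a + d) a) (pverts (gen_johnson n (a + d) a) - W)"
proof -
  let ?G = "gen_johnson n (a + d) a"
  have "finite (pverts ?G)" by (simp add: gen_johnson_def)
  then have "finite W" using assms(1) by (rule rev_finite_subset)
  then have "(force_step ?G)\<^sup>*\<^sup>* (pverts ?G - W) (pverts ?G)" using assms(1,2)
  \<comment> \<open>Forcing \<open>B0\<close> turns the white set into \<open>W - {B0}\<close>,
    which still obeys the size bound.\<close>
  proof (induction W rule: finite_psubset_induct)
    case (psubset W)
    show ?case
    proof (cases "W = {}")
      case False
      obtain A B0 where A: "A \<subseteq> {1..n}" "card A = a + d" "A \<notin> W"
          and B0: "{B \<in> W. card (A \<inter> B) = a} = {B0}"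
      proof -
        have "B \<subseteq> {1..n} \<and> card B = a + d" if "B \<in> W" for B
          using that psubset.prems(1) by (auto simp: gen_johnson_def)
        then show ?thesis
          using exists_unique_neighbour[of W a "{1..n}" d] psubset.hyps psubset.prems(2) False n
            \<open>d > 0\<close> that by auto
      qed
      have "B0 \<in> W" using B0 by blast
      have "{w. (A, w) \<in> parcs ?G \<and> w \<notin> pverts ?G - W} = {B \<in> W. card (A \<inter> B) = a}"
        using A psubset.prems(1) by (auto simp: gen_johnson_def)
      moreover have "A \<in> pverts ?G - W" using A by (simp add: gen_johnson_def)
      moreover have "insert B0 (pverts ?G - W) = pverts ?G - (W - {B0})"
        using \<open>B0 \<in> W\<close> psubset.prems(1) by blast
      ultimately have "force_step ?G (pverts ?G - W) (pverts ?G - (W - {B0}))"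
        unfolding force_step_def using B0
        by (intro bexI[of _ A] exI[of _ B0] conjI) simp_all
      moreover have "(force_step ?G)\<^sup>*\<^sup>* (pverts ?G - (W - {B0})) (pverts ?G)"
        using psubset.prems psubset.hyps \<open>B0 \<in> W\<close> by (intro psubset.IH) auto
      ultimately show ?thesis by (rule converse_rtranclp_into_rtranclp)
    qed simp
  qed
  then show ?thesis by (simp add: zero_forcing_set_def)
qed

text \<open>The white neighbours of \<open>A\<close> are the \<open>X - {y}\<close> with
  \<open>y \<in> A \<inter> Y\<close> if \<open>card (A \<inter> X) = a + 1\<close>, those with
  \<open>y \<in> Y - A\<close> if \<open>card (A \<inter> X) = a\<close>, and none otherwise.
  Neither index set can be a singleton.\<close>

lemma zero_blocking_set_gen_johnson:
  assumes "k \<le> 2 * a" "a < k" "k < n"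
  shows "\<exists>W. zero_blocking_set (gen_johnson n k a) W \<and> card W = a + 2"
proof -
  let ?G = "gen_johnson n k a"
  obtain X where X: "X \<subseteq> {1..n}" "card X = k + 1" "finite X"
    using obtain_subset_with_card_n[of "k + 1" "{1..n}"] assms(3) by auto
  obtain Y where YX: "Y \<subseteq> X" and Y: "card Y = a + 2" "finite Y"
    using obtain_subset_with_card_n[of "a + 2" X] assms(2) X(2) by auto
  let ?W = "(\<lambda>y. X - {y}) ` Y"
  have card_Int: "card (A \<inter> (X - {y})) = (if y \<in> A then card (A \<inter> X) - 1 else card (A \<inter> X))"
    if "y \<in> Y" for A y
  proof -
    have "A \<inter> (X - {y}) = (A \<inter> X) - {y}" by blast
    then show ?thesis using that YX by (auto simp: card_Diff_singleton)
  qed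
  have "inj_on (\<lambda>y. X - {y}) Y" using YX by (intro inj_onI) blast
  then have cardW: "card ?W = a + 2" using Y(1) by (simp add: card_image)
  have WV: "?W \<subseteq> pverts ?G"
    using YX X by (auto simp: gen_johnson_def card_Diff_singleton)
  have no_step: "\<not> force_step ?G (pverts ?G - ?W) T" for T
  proof
    assume "force_step ?G (pverts ?G - ?W) T"
    then obtain A v where A: "A \<in> pverts ?G"
        and "{w. (A, w) \<in> parcs ?G \<and> w \<notin> pverts ?G - ?W} = {v}"
      unfolding force_step_def by blast
    moreover have "{w. (A, w) \<in> parcs ?G \<and> w \<notin> pverts ?G - ?W} = {B \<in> ?W. card (A \<inter> B) = a}"
      using A WV by (auto simp: gen_johnson_def)
    ultimately have v: "{B \<in> ?W. card (A \<inter> B) = a} = {v}" by simp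
    then have "v \<in> {B \<in> ?W. card (A \<inter> B) = a}" by simp
    then obtain y where y: "y \<in> Y" "v = X - {y}" "card (A \<inter> (X - {y})) = a" by blast
    have other: "card (A \<inter> (X - {z})) \<noteq> a" if "z \<in> Y" "z \<noteq> y" for z
    proof
      assume "card (A \<inter> (X - {z})) = a"
      then have "X - {z} \<in> {B \<in> ?W. card (A \<inter> B) = a}" using that(1) by blast
      then have "X - {z} = X - {y}" unfolding v using y(2) by simp
      then show False using that YX by blast
    qed
    show False
    proof (cases "y \<in> A")
      case True
      have "A \<inter> Y \<subseteq> {y}"
      proof
        fix z assume "z \<in> A \<inter> Y"
        then show "z \<in> {y}" using other[of z] y(1,3) card_Int[of z A] card_Int[of y A] True by auto
      qed
      then have "A \<inter> X \<subseteq> insert y (X - Y)" by blast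
      then have "card (A \<inter> X) \<le> card (insert y (X - Y))" using X(3) by (intro card_mono) auto
      also have "\<dots> = Suc (card (X - Y))" using y(1) X(3) by (subst card_insert_disjoint) auto
      also have "card (X - Y) = k + 1 - (a + 2)" using card_Diff_subset[OF Y(2) YX] X(2) Y(1) by simp
      \<comment> \<open>The bound is \<open>1 + (k - 1 - a) = k - a\<close>, at most
        \<open>a\<close> by \<open>k \<le> 2 * a\<close>, whereas adjacency to
        \<open>X - {y}\<close> with \<open>y \<in> A\<close> needs \<open>a + 1\<close>.\<close>
      finally have "card (A \<inter> X) \<le> a" using assms(1,2) by linarith
      moreover have "y \<in> A \<inter> X" using True y(1) YX by blast
      then have "card (A \<inter> X) > 0" using X(3) by (auto simp: card_gt_0_iff)
      ultimately show False using y(3) card_Int[OF y(1), of A] True by simp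
    next
      case False
      have "Y - {y} \<subseteq> A \<inter> X"
      proof
        fix z assume "z \<in> Y - {y}"
        then show "z \<in> A \<inter> X"
          using other[of z] y(1,3) card_Int[of z A] card_Int[of y A] False YX by (auto split: if_splits)
      qed
      \<comment> \<open>Here \<open>Y - {y}\<close> has \<open>a + 1\<close> points, while
        \<open>card (A \<inter> X) = a\<close>.\<close>
      then have "card (Y - {y}) \<le> card (A \<inter> X)" using X(3) by (intro card_mono) auto
      then show False using y(1,3) card_Int[OF y(1), of A] False Y by (simp add: card_Diff_singleton)
    qed
  qed
  have "\<not> (force_step ?G)\<^sup>*\<^sup>* (pverts ?G - ?W) (pverts ?G)"
  proof
    assume "(force_step ?G)\<^sup>*\<^sup>* (pverts ?G - ?W) (pverts ?G)"
    then have "pverts ?G - ?W = pverts ?G" using no_step by (metis converse_rtranclpE)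
    then show False using WV cardW by (cases "?W = {}") auto
  qed
  then have "zero_blocking_set ?G ?W"
    using WV by (simp add: zero_blocking_set_def failed_zero_forcing_set_def zero_forcing_set_def)
  then show ?thesis using cardW by blast
qed

theorem theorem16:
  fixes n k a :: nat
  assumes "n \<ge> k" and "k > a" and "a \<ge> 0"
    and "real n \<ge> (real a + 5 / 2) * (real k - real a + 2) - 6"
    and "real k - 2 \<ge> real a" and "real a \<ge> real k / 2"
  shows "zero_blocking_number (gen_johnson n k a) = a + 2"
proof -
  obtain d where k: "k = a + d" using \<open>k > a\<close> less_imp_add_positive by blast
  have d: "d \<ge> 2" "d \<le> a" using assms(5,6) k by auto
  \<comment> \<open>With \<open>k = a + d\<close> the assumed bound equals
    \<open>a * (d + 2) + 2 * d + (d / 2 - 1)\<close>, and \<open>d \<ge> 2\<close>.\<close>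
  have "real (a * (d + 2) + 2 * d) \<le> real n"
    using assms(4) of_nat_mono[OF d(1), where 'a = real] unfolding k by (simp add: field_simps)
  then have n: "a * (d + 2) + 2 * d \<le> n" by (simp only: of_nat_le_iff)
  then have "k < n" using d k by (simp add: algebra_simps)
  show ?thesis
    unfolding zero_blocking_number_def
  proof (rule Least_equality)
    show "\<exists>W. zero_blocking_set (gen_johnson n k a) W \<and> card W = a + 2"
      using d k \<open>k < n\<close> by (intro zero_blocking_set_gen_johnson) auto
  next
    fix m
    assume "\<exists>W. zero_blocking_set (gen_johnson n k a) W \<and> card W = m"
    then obtain W where "zero_blocking_set (gen_johnson n k a) W" "card W = m" by blast
    then show "a + 2 \<le> m"
      using zero_forcing_set_gen_johnson[of W n a d] n d(1) k
      by (force simp: zero_blocking_set_def failed_zero_forcing_set_def)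
  qed
qed

end
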